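(* Let $R_N(L)$ be the secret-key rate achieved by a repeater chain of $N$ equal-length elementary links over total range $L$, let $R_N^{(0)}(L)$ be the same rate with all detector dark-click probabilities set to zero (both defined in the context), and let $R(L)$ be the rate-versus-distance function obtained by optimizing $R_N(L)$ over the number $N\ge1$ of elementary links as a function of $L$. Let $\eta=e^{-\alpha L}$. Assuming that $R_N(L)\le R_N^{(0)}(L)$ holds for all $N\ge1$, one has $$R(L)\le R^{(\rm UB)}(L)=A\,\eta^{t},$$ where $$A=\frac{\eta_d^2}{\eta_r^2\lambda_m^2T_q},\qquad t=\frac{\log\left(\eta_r^2\lambda_m^2/2\right)}{\log\left(2/(M\eta_e^2)\right)}.$$
   Context: Parameters: $M\ge1$ is the (integer) number of frequency modes; $\alpha>0$ is the fiber loss coefficient; $T_q>0$ is the qubit duration; $\eta_e,\eta_r,\eta_d\in(0,1]$ and $P_e,P_r,P_d\in[0,1)$ are the efficiencies and dark-click probabilities of the detectors at the elementary-link centers, at the repeater nodes, and at the two end stations respectively; $\lambda_m\in(0,1]$ is the memory efficiency. The rate $R_N(L)$ is defined as follows. Let $\lambda=e^{-\alpha L/(2N)}$. Put $A_r=\eta_r\lambda_m+P_r(1-\eta_r\lambda_m)$, $B_r=1-(1-P_r)(1-\eta_r\lambda_m)^2$, $$a=\tfrac18\left[P_r^2(1-A_r)^2+A_r^2(1-P_r)^2\right],\quad b=\tfrac18\left[2A_rP_r(1-A_r)(1-P_r)\right],\quad c=\tfrac18P_r(1-P_r)\left[P_r(1-B_r)+B_r(1-P_r)\right],$$ and let $a_e,b_e,c_e$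 be the same expressions with $(P_r,A_r,B_r)$ replaced by $(P_e,A_e,B_e)$, where $A_e=\eta_e\lambda+P_e(1-\eta_e\lambda)$, $B_e=1-(1-P_e)(1-\eta_e\lambda)^2$. Put $s=a+b+2c$, $s_1=a_e+b_e+2c_e$, $t_r=(a+b-2c)/(a+b+2c)$, $t_e=(a_e+b_e-2c_e)/(a_e+b_e+2c_e)$, $A_d=\eta_d+(1-\eta_d)P_d$, $q_1=(1-P_d)A_d$, $q_2=(1-A_d)P_d$, $q_3=P_dA_d$, $t_d=((q_1-q_2)/(q_1+q_2+q_3))^2$, $P_1=(q_1+q_2+q_3)^2$, $$P_{\rm succ}=(4s)^{N-1}\left(1-(1-4s_1)^M\right)^N,\qquad Q(N)=\tfrac12\left[1-\tfrac{t_d}{t_r}(t_rt_e)^N\right],$$ where $\tfrac{t_d}{t_r}(t_rt_e)^N$ is read as $t_d\,t_r^{N-1}t_e^N$. Let $h_2(x)=-x\log_2x-(1-x)\log_2(1-x)$, $R_2(Q)=1-2h_2(Q)$, and let $Q_{\rm th}\in(0,1/2)$ satisfy $h_2(Q_{\rm th})=1/2$. Then $$R_N(L)=\frac{P_1P_{\rm succ}R_2(Q(N))}{2T_q},$$ with the rate being zero once $Q(N)\ge Q_{\rm th}$. $R_N^{(0)}(L)$ is the same quantity with $P_e=P_r=P_d=0$ and all other parameters unchanged.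
   Formalization: The formal theorem additionally assumes t ≤ 1; without it the bound fails, e.g. M=3, all efficiencies 1, no dark clicks, T_q=1, η=1/10: R_1≈0.071 but Aη^t≈0.020. Where Mη_e²=2 and t is undefined, it reads t=0. *)

theory Defs
  imports Complex_Main
begin

text \<open>Suffixes: \<open>e\<close> = centers of the elementary links, \<open>r\<close> = repeater nodes, \<open>d\<close> = end stations;
  \<open>eff\<close> is a detector efficiency and \<open>dark\<close> a dark-click probability.\<close>

record repeater =
  modes :: nat
  loss :: real
  T_q :: real
  eff_e :: real
  eff_r :: real
  eff_d :: real
  dark_e :: real
  dark_r :: real
  dark_d :: real
  mem_eff :: real

definition valid_repeater :: "repeater \<Rightarrow> bool" where
  "valid_repeater p \<longleftrightarrow>
     modes p \<ge> 1 \<and> loss p > 0 \<and> T_q p > 0 \<and>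
     eff_e p \<in> {0<..1} \<and> eff_r p \<in> {0<..1} \<and> eff_d p \<in> {0<..1} \<and>
     dark_e p \<in> {0..<1} \<and> dark_r p \<in> {0..<1} \<and> dark_d p \<in> {0..<1} \<and>
     mem_eff p \<in> {0<..1}"

definition no_dark :: "repeater \<Rightarrow> repeater" where
  "no_dark p = p\<lparr>dark_e := 0, dark_r := 0, dark_d := 0\<rparr>"

definition link_trans :: "repeater \<Rightarrow> nat \<Rightarrow> real \<Rightarrow> real" where
  "link_trans p N L = exp (- loss p * L / (2 * real N))"

definition total_trans :: "repeater \<Rightarrow> real \<Rightarrow> real" where
  "total_trans p L = exp (- loss p * L)"

text \<open>In the following, \<open>x\<close> is the overall efficiency with which a photon is detected:
  \<open>eff_r p * mem_eff p\<close> at a repeater node, \<open>eff_e p * link_trans p N L\<close> at a link center,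
  and \<open>eff_d p\<close> at an end station.\<close>

definition click_A :: "real \<Rightarrow> real \<Rightarrow> real" where
  "click_A P x = x + P * (1 - x)"

definition click_B :: "real \<Rightarrow> real \<Rightarrow> real" where
  "click_B P x = 1 - (1 - P) * (1 - x)\<^sup>2"

definition coef_a :: "real \<Rightarrow> real \<Rightarrow> real" where
  "coef_a P x = (let A = click_A P x in
     1/8 * (P\<^sup>2 * (1 - A)\<^sup>2 + A\<^sup>2 * (1 - P)\<^sup>2))"

definition coef_b :: "real \<Rightarrow> real \<Rightarrow> real" where
  "coef_b P x = (let A = click_A P x in
     1/8 * (2 * A * P * (1 - A) * (1 - P)))"

definition coef_c :: "real \<Rightarrow> real \<Rightarrow> real" where
  "coef_c P x = (let B = click_B P x in
     1/8 * P * (1 - P) * (P * (1 - B) + B * (1 - P)))"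

definition swap_s :: "real \<Rightarrow> real \<Rightarrow> real" where
  "swap_s P x = coef_a P x + coef_b P x + 2 * coef_c P x"

definition swap_t :: "real \<Rightarrow> real \<Rightarrow> real" where
  "swap_t P x = (coef_a P x + coef_b P x - 2 * coef_c P x) /
                (coef_a P x + coef_b P x + 2 * coef_c P x)"

definition s_node :: "repeater \<Rightarrow> real" where
  "s_node p = swap_s (dark_r p) (eff_r p * mem_eff p)"

definition s_link :: "repeater \<Rightarrow> nat \<Rightarrow> real \<Rightarrow> real" where
  "s_link p N L = swap_s (dark_e p) (eff_e p * link_trans p N L)"

definition t_node :: "repeater \<Rightarrow> real" where
  "t_node p = swap_t (dark_r p) (eff_r p * mem_eff p)"

definition t_link :: "repeater \<Rightarrow> nat \<Rightarrow> real \<Rightarrow> real" where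
  "t_link p N L = swap_t (dark_e p) (eff_e p * link_trans p N L)"

definition q1 :: "repeater \<Rightarrow> real" where
  "q1 p = (1 - dark_d p) * click_A (dark_d p) (eff_d p)"

definition q2 :: "repeater \<Rightarrow> real" where
  "q2 p = (1 - click_A (dark_d p) (eff_d p)) * dark_d p"

definition q3 :: "repeater \<Rightarrow> real" where
  "q3 p = dark_d p * click_A (dark_d p) (eff_d p)"

definition t_end :: "repeater \<Rightarrow> real" where
  "t_end p = ((q1 p - q2 p) / (q1 p + q2 p + q3 p))\<^sup>2"

definition P_end :: "repeater \<Rightarrow> real" where
  "P_end p = (q1 p + q2 p + q3 p)\<^sup>2"

definition P_succ :: "repeater \<Rightarrow> nat \<Rightarrow> real \<Rightarrow> real" where
  "P_succ p N L = (4 * s_node p) ^ (N - 1) * (1 - (1 - 4 * s_link p N L) ^ modes p) ^ N"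

definition err_Q :: "repeater \<Rightarrow> nat \<Rightarrow> real \<Rightarrow> real" where
  "err_Q p N L = 1/2 * (1 - t_end p * t_node p ^ (N - 1) * t_link p N L ^ N)"

text \<open>Since \<open>log 2 0 = 0\<close>, the convention \<open>0 log 0 = 0\<close> is built in.\<close>

definition h2 :: "real \<Rightarrow> real" where
  "h2 x = - x * log 2 x - (1 - x) * log 2 (1 - x)"

definition R2 :: "real \<Rightarrow> real" where
  "R2 Q = 1 - 2 * h2 Q"

definition Q_th :: real where
  "Q_th = (THE x. 0 < x \<and> x < 1/2 \<and> h2 x = 1/2)"

definition link_rate :: "repeater \<Rightarrow> nat \<Rightarrow> real \<Rightarrow> real" where
  "link_rate p N L =
     (if err_Q p N L \<ge> Q_th then 0
      else P_end p * P_succ p N L * R2 (err_Q p N L) / (2 * T_q p))"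

text \<open>A supremum of reals is meaningful only for a bounded family. If \<open>link_rate p N L\<close> is at most
  \<open>link_rate (no_dark p) N L\<close> for all \<open>N \<ge> 1\<close>, the family is bounded, since the latter rates are
  at most \<open>1 / T_q p\<close>.\<close>

definition opt_rate :: "repeater \<Rightarrow> real \<Rightarrow> real" where
  "opt_rate p L = (SUP N\<in>{1..}. link_rate p N L)"

definition ub_prefactor :: "repeater \<Rightarrow> real" where
  "ub_prefactor p = (eff_d p)\<^sup>2 / ((eff_r p)\<^sup>2 * (mem_eff p)\<^sup>2 * T_q p)"

text \<open>For \<open>modes p * (eff_e p)\<^sup>2 = 2\<close> the exponent is a quotient with denominator \<open>0\<close>, hence \<open>0\<close> here.

  The exponent exceeds \<open>1\<close> exactly if
  \<open>2 < modes p * (eff_e p)\<^sup>2 < 4 / ((eff_r p)\<^sup>2 * (mem_eff p)\<^sup>2)\<close>. In that range the bound \<open>rate_UB\<close> below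
  fails at long distances without dark clicks: the rate for \<open>N = 1\<close> decays like \<open>total_trans p L\<close>,
  the bound like a higher power of it.\<close>

definition ub_exponent :: "repeater \<Rightarrow> real" where
  "ub_exponent p =
     ln ((eff_r p)\<^sup>2 * (mem_eff p)\<^sup>2 / 2) / ln (2 / (real (modes p) * (eff_e p)\<^sup>2))"

definition rate_UB :: "repeater \<Rightarrow> real \<Rightarrow> real" where
  "rate_UB p L = ub_prefactor p * total_trans p L powr ub_exponent p"

lemma h2_strict_mono:
  assumes "0 < x" "x < y" "y \<le> 1/2"
  shows "h2 x < h2 y"
proof (rule DERIV_pos_imp_increasing_open[OF assms(2)])
  fix z assume z: "x < z" "z < y"
  have z0: "0 < z" "z < 1/2" using z assms by auto
  have h2_eq: "h2 = (\<lambda>x. (- x * ln x - (1 - x) * ln (1 - x)) / ln 2)"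
    by (rule ext) (simp add: h2_def log_def diff_divide_distrib)
  have "((\<lambda>x. - x * ln x - (1 - x) * ln (1 - x)) has_real_derivative ln (1 - z) - ln z) (at z)"
    using z0 by (auto intro!: derivative_eq_intros)
  then have "(h2 has_real_derivative (ln (1 - z) - ln z) / ln 2) (at z)"
    unfolding h2_eq by (rule DERIV_cdivide)
  moreover have "(ln (1 - z) - ln z) / ln 2 > 0" using z0 by simp
  ultimately show "\<exists>d. (h2 has_real_derivative d) (at z) \<and> d > 0" by blast
next
  show "continuous_on {x..y} h2"
    unfolding h2_def[abs_def] log_def using assms
    by (auto intro!: continuous_intros)
qed

lemma Q_th_ex1: "\<exists>!x. 0 < x \<and> x < 1/2 \<and> h2 x = 1/2"
proof -
  have half: "h2 (1/2) = 1" by (simp add: h2_def log_divide)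
  have ln2: "ln 2 \<ge> (1/2::real)" using ln_le_minus_one[of "1/2::real"] by (simp add: ln_div)
  have l16: "ln (1/16::real) = - 4 * ln 2"
    using ln_realpow[of "2::real" 4] by (simp add: ln_div)
  have "- ln (15/16::real) = ln (16/15)" by (simp add: ln_div)
  also have "\<dots> \<le> 1/15" using ln_le_minus_one[of "16/15::real"] by simp
  finally have l15: "- ln (15/16::real) \<le> 1/15" .
  have "h2 (1/16) = 1/4 + (15/16) * (- ln (15/16)) / ln 2"
    using ln2 by (simp add: h2_def log_def l16)
  also have "\<dots> \<le> 1/4 + (15/16) * (1/15) / ln 2"
    using l15 ln2 by (intro add_left_mono divide_right_mono mult_left_mono) auto
  also have "\<dots> < 1/2" using ln2 by (simp add: field_simps)
  finally have low: "h2 (1/16) < 1/2" .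
  have "\<exists>x\<ge>1/16. x \<le> 1/2 \<and> h2 x = 1/2"
  proof (rule IVT')
    show "continuous_on {1/16..1/2} h2"
      unfolding h2_def[abs_def] log_def by (auto intro!: continuous_intros)
  qed (use low half in auto)
  then obtain x where x: "1/16 \<le> x" "x \<le> 1/2" "h2 x = 1/2" by auto
  have "x \<noteq> 1/2"
  proof
    assume "x = 1/2"
    with half x(3) show False by simp
  qed
  with x have "0 < x \<and> x < 1/2 \<and> h2 x = 1/2" by auto
  then show ?thesis
  proof (rule ex1I)
    fix y assume y: "0 < y \<and> y < 1/2 \<and> h2 y = 1/2"
    show "y = x"
    proof (rule ccontr)
      assume "y \<noteq> x"
      then have "x < y \<or> y < x" by auto
      then show False using h2_strict_mono[of x y] h2_strict_mono[of y x] x y by force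
    qed
  qed
qed

end

theory Submission
  imports Defs
begin

text \<open>Without dark clicks every error vanishes. Put
  \<open>v = \<eta>\<^sub>r\<^sup>2 \<lambda>\<^sub>m\<^sup>2 / 2\<close> and let \<open>y = \<eta> powr (1/N)\<close> be the transmissivity of one link. The rate is
  then the prefactor times the \<open>N\<close>-th power of \<open>v (1 - (1 - \<eta>\<^sub>e\<^sup>2 y / 2) ^ M)\<close>, and the bound is
  the prefactor times the \<open>N\<close>-th power of \<open>y powr t\<close>. So it suffices to compare the two bases, for
  every \<open>y\<close> in \<open>(0,1]\<close>. With \<open>m = M \<eta>\<^sub>e\<^sup>2 / 2\<close>, the former is at most \<open>v min (1, m y)\<close>. If \<open>m > 1\<close>,
  the power \<open>y powr t\<close> takes the value \<open>v\<close> at the kink \<open>y = 1 / m\<close>; to the right of it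
  \<open>t \<ge> 0\<close> suffices, to the left \<open>t \<le> 1\<close>. If \<open>m \<le> 1\<close>, then \<open>t \<le> 0\<close> and the bound is trivial.\<close>

lemma swap_s_0: "swap_s 0 x = x\<^sup>2 / 8"
  by (simp add: swap_s_def coef_a_def coef_b_def coef_c_def click_A_def)

lemma swap_t_0: "x \<noteq> 0 \<Longrightarrow> swap_t 0 x = 1"
  by (simp add: swap_t_def coef_a_def coef_b_def coef_c_def click_A_def)

lemma link_rate_no_dark:
  assumes "valid_repeater p"
  shows "link_rate (no_dark p) N L =
    (eff_d p)\<^sup>2 * ((eff_r p * mem_eff p)\<^sup>2 / 2) ^ (N - 1) *
    (1 - (1 - (eff_e p * link_trans p N L)\<^sup>2 / 2) ^ modes p) ^ N / (2 * T_q p)"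
proof -
  have pos: "eff_e p > 0" "eff_r p > 0" "eff_d p > 0" "mem_eff p > 0"
    using assms by (auto simp: valid_repeater_def)
  have lt: "link_trans (no_dark p) N L = link_trans p N L" "link_trans p N L > 0"
    by (simp_all add: link_trans_def no_dark_def)
  have q: "q1 (no_dark p) = eff_d p" "q2 (no_dark p) = 0" "q3 (no_dark p) = 0"
    by (simp_all add: q1_def q2_def q3_def no_dark_def click_A_def)
  have s: "s_node (no_dark p) = (eff_r p * mem_eff p)\<^sup>2 / 8"
      "s_link (no_dark p) N L = (eff_e p * link_trans p N L)\<^sup>2 / 8"
    unfolding s_node_def s_link_def lt by (simp_all add: swap_s_0 no_dark_def)
  have t: "t_node (no_dark p) = 1" "t_link (no_dark p) N L = 1"
    unfolding t_node_def t_link_def lt using pos lt(2) by (simp_all add: swap_t_0 no_dark_def)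
  have "err_Q (no_dark p) N L = 0"
    unfolding err_Q_def t using pos by (simp add: t_end_def q)
  \<comment> \<open>The error \<open>0\<close> lies below the threshold, so the rate is not cut off,
    and \<open>R2 0 = 1\<close>.\<close>
  moreover have "Q_th > 0"
    using theI'[OF Q_th_ex1] unfolding Q_th_def by blast
  ultimately show ?thesis
    by (simp add: link_rate_def R2_def h2_def P_end_def q P_succ_def s) (simp add: no_dark_def)
qed

text \<open>The comparison of bases for a single link; \<open>e\<close> stands for the square of
  \<open>eff_e p\<close>.\<close>

lemma link_success_le_powr:
  fixes v e y :: real and M :: nat
  defines "m \<equiv> real M * e / 2"
  defines "t \<equiv> ln v / ln (1 / m)"
  assumes v: "0 < v" "v \<le> 1" and e: "0 < e" "e \<le> 1" and y: "0 < y" "y \<le> 1"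
    and M: "M \<ge> 1" and t: "t \<le> 1"
  shows "v * (1 - (1 - e * y / 2) ^ M) \<le> y powr t"
proof -
  have m: "m > 0" using e M by (simp add: m_def)
  have ey: "0 \<le> e * y" "e * y \<le> 1" using e y by (simp_all add: mult_le_one)
  have le_one: "1 - (1 - e * y / 2) ^ M \<le> 1" using ey by simp
  then have le_v: "v * (1 - (1 - e * y / 2) ^ M) \<le> v" using v by (simp add: mult_left_le)
  have ln_inv: "ln (1 / m) = - ln m" using m by (simp add: ln_div)
  show ?thesis
  proof (cases "m \<le> 1")
    case True
    \<comment> \<open>If \<open>m = 1\<close>, the denominator is \<open>0\<close> and division by
      zero gives \<open>t = 0\<close>.\<close>
    then have "t \<le> 0"
      unfolding t_def ln_inv using v m by (intro divide_nonpos_nonneg) auto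
    then have "1 \<le> y powr t"
      using y by (simp add: powr_def mult_nonpos_nonpos)
    with le_v v show ?thesis by linarith
  next
    case False
    then have lnm: "ln m > 0" by simp
    have t0: "t \<ge> 0"
      unfolding t_def ln_inv using v lnm by (intro divide_nonpos_neg) auto
    \<comment> \<open>Scaling \<open>y\<close> by \<open>m\<close> moves the kink to
      \<open>1\<close> and makes \<open>v\<close> a common factor of both sides.\<close>
    have "(1 / m) powr t = v"
      using v m lnm by (simp add: powr_def t_def ln_inv)
    then have powr_t: "y powr t = v * (m * y) powr t"
      using y m by (simp add: powr_mult powr_divide field_simps)
    show ?thesis
    proof (cases "m * y \<ge> 1")
      case True
      then have "1 \<le> (m * y) powr t" using t0 by (rule ge_one_powr_ge_zero)
      with le_v v show ?thesis unfolding powr_t by (smt (verit) mult_le_cancel_left1)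
    next
      case False
      \<comment> \<open>Bernoulli's inequality acts as a union bound over the \<open>M\<close>
        modes.\<close>
      have "1 - (1 - e * y / 2) ^ M \<le> m * y"
        using Bernoulli_inequality[of "- (e * y / 2)" M] ey by (simp add: m_def algebra_simps)
      also have "m * y \<le> (m * y) powr t"
        using powr_mono'[of t 1 "m * y"] t False m y by simp
      finally show ?thesis unfolding powr_t using v by simp
    qed
  qed
qed

lemma link_rate_no_dark_le_rate_UB:
  assumes p: "valid_repeater p" and L: "L \<ge> 0" and N: "N \<ge> 1" and t: "ub_exponent p \<le> 1"
  shows "link_rate (no_dark p) N L \<le> rate_UB p L"
proof -
  define u where "u = (eff_r p * mem_eff p)\<^sup>2"
  \<comment> \<open>\<open>link_trans\<close> covers half a link, its square a whole one.\<close>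
  define y where "y = (link_trans p N L)\<^sup>2"
  define g where "g = 1 - (1 - (eff_e p)\<^sup>2 * y / 2) ^ modes p"
  have bounds: "0 < eff_e p" "eff_e p \<le> 1" "0 < eff_r p" "eff_r p \<le> 1"
      "0 < mem_eff p" "mem_eff p \<le> 1" "modes p \<ge> 1" "loss p > 0" "T_q p > 0"
    using p by (auto simp: valid_repeater_def)
  have e: "0 < (eff_e p)\<^sup>2" "(eff_e p)\<^sup>2 \<le> 1"
    using bounds by (simp_all add: power_le_one)
  have u: "0 < u" "u \<le> 1"
    using bounds by (simp_all add: u_def power_le_one mult_le_one)
  have y_eq: "y = exp (- loss p * L / real N)"
    using N by (simp add: y_def link_trans_def flip: exp_double)
  have y: "0 < y" "y \<le> 1"
    using bounds L by (simp_all add: y_eq)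
  have exponent: "ub_exponent p = ln (u / 2) / ln (1 / (real (modes p) * (eff_e p)\<^sup>2 / 2))"
    by (simp add: ub_exponent_def u_def power_mult_distrib)
  have "u / 2 * g \<le> y powr ub_exponent p"
    unfolding g_def exponent
    using u e y bounds t[unfolded exponent] by (intro link_success_le_powr) auto
  moreover have "0 \<le> g"
    using mult_le_one[of "(eff_e p)\<^sup>2" y] e y by (simp add: g_def power_le_one)
  ultimately have "(u / 2 * g) ^ N \<le> (y powr ub_exponent p) ^ N"
    using u by (intro power_mono) auto
  also have "\<dots> = total_trans p L powr ub_exponent p"
    using N by (simp add: y_eq total_trans_def powr_def flip: exp_of_nat_mult)
  finally have powers: "(u / 2 * g) ^ N \<le> total_trans p L powr ub_exponent p" .
  have "link_rate (no_dark p) N L = (eff_d p)\<^sup>2 * (u / 2) ^ (N - 1) * g ^ N / (2 * T_q p)"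
    by (simp add: link_rate_no_dark[OF p] u_def g_def y_def power_mult_distrib)
  \<comment> \<open>There is one node fewer than links: supplying the missing factor
    \<open>u / 2\<close> cancels the \<open>2\<close> of the denominator and leaves
    \<open>1 / u\<close> in the prefactor.\<close>
  also have "\<dots> = ub_prefactor p * (u / 2 * g) ^ N"
  proof -
    have power: "(u / 2) ^ N = u / 2 * (u / 2) ^ (N - 1)"
      using N by (simp add: power_eq_if)
    have prefactor: "ub_prefactor p = (eff_d p)\<^sup>2 / (u * T_q p)"
      by (simp add: ub_prefactor_def u_def power_mult_distrib)
    show ?thesis
      unfolding power_mult_distrib[of "u / 2" g] power prefactor using u bounds by simp
  qed
  also have "\<dots> \<le> rate_UB p L"
    unfolding rate_UB_def using powers bounds
    by (intro mult_left_mono) (auto simp: ub_prefactor_def)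
  finally show ?thesis .
qed

theorem theorem4:
  fixes p :: repeater and L :: real
  assumes "valid_repeater p"
    and "L \<ge> 0"
    and "\<forall>N\<ge>1. link_rate p N L \<le> link_rate (no_dark p) N L"
    and "ub_exponent p \<le> 1"
  shows "opt_rate p L \<le> rate_UB p L"
  unfolding opt_rate_def
proof (rule cSUP_least)
  fix N :: nat
  assume "N \<in> {1..}"
  then have N: "N \<ge> 1" by simp
  then have "link_rate p N L \<le> link_rate (no_dark p) N L" using assms(3) by blast
  also have "\<dots> \<le> rate_UB p L" using link_rate_no_dark_le_rate_UB assms N by blast
  finally show "link_rate p N L \<le> rate_UB p L" .
qed simp

end
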